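(* Let $\mathscr K$ be an ultracontact on a non-trivial Boolean algebra $B$ and let $\mathcal G$ be a non-empty collection of grills of $B$. Then $\mathscr K^{\mathcal G}=\mathscr K\cup\{F\subseteq B: F\neq\emptyset \text{ and } F\subseteq G \text{ for some } G\in\mathcal G\}$ is an ultracontact on $B$. Moreover, $\mathscr K^{\mathcal G}$ is the smallest ultracontact on $B$ that contains $\mathscr K$ and contains every grill belonging to $\mathcal G$ as an element.
   Context: Let $B$ be a non-trivial Boolean algebra with order $\le$ and join $+$. A grill of $B$ is a non-empty set $G\subseteq B$ such that $0\notin G$; if $a\in G$ and $a\le b$ then $b\in G$; and if $a+b\in G$ then $a\in G$ or $b\in G$. For $F,G\subseteq B$ put $F+G=\{f+g: f\in F,\ g\in G\}$, and write $F\preceq G$ iff for every $g\in G$ there is $f\in F$ with $f\le g$. An ultracontact on $B$ is a family $\mathscr K\subseteq 2^B$ such that for all $F,G\subseteq B$: (K0) $\emptyset\notin\mathscr K$; (K1) if $0\in F$ then $F\notin\mathscr K$; (K2) if $x\neq 0$ then $\{x\}\in\mathscr K$; (K3) if $F\preceq G$, $G\neq\emptyset$ and $F\in\mathscr K$, then $G\in\mathscr K$; (K4) if $F+G\in\mathscr K$ then $F\in\mathscr K$ or $G\in\mathscr K$. *)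

theory Defs
  imports Main
begin

definition grill :: "'a::boolean_algebra set \<Rightarrow> bool" where
  "grill G \<longleftrightarrow> G \<noteq> {} \<and> bot \<notin> G \<and>
     (\<forall>a b. a \<in> G \<longrightarrow> a \<le> b \<longrightarrow> b \<in> G) \<and>
     (\<forall>a b. sup a b \<in> G \<longrightarrow> a \<in> G \<or> b \<in> G)"

definition join_set :: "'a::boolean_algebra set \<Rightarrow> 'a set \<Rightarrow> 'a set" where
  "join_set F G = {sup f g | f g. f \<in> F \<and> g \<in> G}"

definition set_preceq :: "'a::boolean_algebra set \<Rightarrow> 'a set \<Rightarrow> bool"  (infix "\<preceq>" 50) where
  "F \<preceq> G \<longleftrightarrow> (\<forall>g\<in>G. \<exists>f\<in>F. f \<le> g)"

definition ultracontact :: "'a::boolean_algebra set set \<Rightarrow> bool" where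
  "ultracontact K \<longleftrightarrow>
     {} \<notin> K \<and>
     (\<forall>F. bot \<in> F \<longrightarrow> F \<notin> K) \<and>
     (\<forall>x. x \<noteq> bot \<longrightarrow> {x} \<in> K) \<and>
     (\<forall>F G. F \<preceq> G \<longrightarrow> G \<noteq> {} \<longrightarrow> F \<in> K \<longrightarrow> G \<in> K) \<and>
     (\<forall>F G. join_set F G \<in> K \<longrightarrow> F \<in> K \<or> G \<in> K)"

definition grill_extension ::
    "'a::boolean_algebra set set \<Rightarrow> 'a set set \<Rightarrow> 'a set set" where
  "grill_extension K \<G> = K \<union> {F. F \<noteq> {} \<and> (\<exists>G\<in>\<G>. F \<subseteq> G)}"

end

theory Submission
  imports Defs
begin

text \<open>The non-empty subsets of a single grill already satisfy every ultracontact axiom except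
  (K2), and (K2) is inherited from \<open>K\<close>. Up-closure of the grill gives (K3) and
  primality gives (K4); these are \<open>grill_superset_set_preceq\<close> and
  \<open>grill_join_set_subset\<close>. No axiom has a premise about two members of the family, so
  taking unions preserves them all. For minimality, \<open>F \<subseteq> G\<close> implies
  \<open>G \<preceq> F\<close>, so (K3) makes any ultracontact containing a grill contain all its
  non-empty subsets as well.\<close>

lemma subset_imp_set_preceq: "F \<subseteq> G \<Longrightarrow> G \<preceq> F"
  unfolding set_preceq_def by blast

lemma grill_superset_set_preceq:
  assumes "grill H" "F \<preceq> G" "F \<subseteq> H"
  shows "G \<subseteq> H"
  using assms unfolding grill_def set_preceq_def by blast

text \<open>This is primality lifted from elements to sets: if some \<open>f\<close> in
  \<open>F\<close> and some \<open>g\<close> in \<open>G\<close> both lay outside \<open>H\<close>,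
  their join would be an element of \<open>H\<close> with neither joinand in
  \<open>H\<close>.\<close>

lemma grill_join_set_subset:
  assumes "grill H" "join_set F G \<subseteq> H"
  shows "F \<subseteq> H \<or> G \<subseteq> H"
proof -
  have "f \<in> H \<or> g \<in> H" if "f \<in> F" "g \<in> G" for f g
  proof -
    have "sup f g \<in> H" using assms(2) that unfolding join_set_def by blast
    then show ?thesis using assms(1) unfolding grill_def by blast
  qed
  then show ?thesis by blast
qed

lemma ultracontact_grill_extension:
  fixes K :: "'a::boolean_algebra set set"
  assumes K: "ultracontact K" and grills: "\<forall>G\<in>\<G>. grill G"
  shows "ultracontact (grill_extension K \<G>)"
  unfolding ultracontact_def
proof (intro conjI allI impI)
  show "{} \<notin> grill_extension K \<G>"
    using K unfolding ultracontact_def grill_extension_def by simp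
next
  fix F :: "'a set"
  assume "bot \<in> F"
  then show "F \<notin> grill_extension K \<G>"
    using K grills unfolding ultracontact_def grill_extension_def grill_def by blast
next
  fix x :: 'a
  assume "x \<noteq> bot"
  then show "{x} \<in> grill_extension K \<G>"
    using K unfolding ultracontact_def grill_extension_def by simp
next
  fix F G :: "'a set"
  assume *: "F \<preceq> G" "G \<noteq> {}" "F \<in> grill_extension K \<G>"
  then consider "F \<in> K" | H where "H \<in> \<G>" "F \<subseteq> H"
    unfolding grill_extension_def by blast
  then show "G \<in> grill_extension K \<G>"
  proof cases
    case 1
    then have "G \<in> K" using K *(1,2) unfolding ultracontact_def by blast
    then show ?thesis unfolding grill_extension_def by simp
  next
    case 2
    \<comment> \<open>Every element of \<open>G\<close> lies above an element of \<open>F\<close>,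
      hence of \<open>H\<close>, and \<open>H\<close> is an up-set.\<close>
    then have "G \<subseteq> H" using grills *(1) grill_superset_set_preceq by blast
    then show ?thesis using 2 *(2) unfolding grill_extension_def by blast
  qed
next
  fix F G :: "'a set"
  assume *: "join_set F G \<in> grill_extension K \<G>"
  then consider "join_set F G \<in> K"
    | H where "H \<in> \<G>" "join_set F G \<noteq> {}" "join_set F G \<subseteq> H"
    unfolding grill_extension_def by blast
  then show "F \<in> grill_extension K \<G> \<or> G \<in> grill_extension K \<G>"
  proof cases
    case 1
    then have "F \<in> K \<or> G \<in> K" using K unfolding ultracontact_def by blast
    then show ?thesis unfolding grill_extension_def by blast
  next
    case 2
    \<comment> \<open>Membership through a grill requires a non-empty set. Whichever of
      \<open>F\<close> and \<open>G\<close> turns out to lie in \<open>H\<close>, it is non-empty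
      because their set of joins is.\<close>
    have "F \<noteq> {}" "G \<noteq> {}" using 2(2) unfolding join_set_def by auto
    moreover have "F \<subseteq> H \<or> G \<subseteq> H" using grills 2 grill_join_set_subset by blast
    ultimately show ?thesis using 2(1) unfolding grill_extension_def by blast
  qed
qed

lemma grill_extension_least:
  assumes "ultracontact K'" "K \<subseteq> K'" "\<forall>G\<in>\<G>. G \<in> K'"
  shows "grill_extension K \<G> \<subseteq> K'"
proof
  fix F
  assume "F \<in> grill_extension K \<G>"
  then consider "F \<in> K" | G where "G \<in> \<G>" "F \<noteq> {}" "F \<subseteq> G"
    unfolding grill_extension_def by blast
  then show "F \<in> K'"
  proof cases
    case 1
    then show ?thesis using assms(2) by blast
  next
    case 2
    \<comment> \<open>Here (K3) is applied to \<open>G \<preceq> F\<close>: the larger set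
      \<open>G\<close> is the one known to be in \<open>K'\<close>, and membership passes down to
      its non-empty subset \<open>F\<close>.\<close>
    then show ?thesis
      using assms(1,3) subset_imp_set_preceq unfolding ultracontact_def by blast
  qed
qed

theorem theorem5p2:
  fixes K :: "'a::boolean_algebra set set" and \<G> :: "'a set set"
  assumes "(bot :: 'a) \<noteq> top"
    and "ultracontact K"
    and "\<G> \<noteq> {}"
    and "\<forall>G\<in>\<G>. grill G"
  shows "ultracontact (grill_extension K \<G>) \<and>
    K \<subseteq> grill_extension K \<G> \<and>
    (\<forall>G\<in>\<G>. G \<in> grill_extension K \<G>) \<and>
    (\<forall>K'. ultracontact K' \<longrightarrow> K \<subseteq> K' \<longrightarrow> (\<forall>G\<in>\<G>. G \<in> K') \<longrightarrow> grill_extension K \<G> \<subseteq> K')"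
proof (intro conjI allI impI)
  show "ultracontact (grill_extension K \<G>)"
    using assms(2,4) by (rule ultracontact_grill_extension)
  show "K \<subseteq> grill_extension K \<G>"
    unfolding grill_extension_def by simp
  \<comment> \<open>A grill is non-empty and a subset of itself, so it serves as its own
    witness.\<close>
  show "\<forall>G\<in>\<G>. G \<in> grill_extension K \<G>"
    using assms(4) unfolding grill_extension_def grill_def by blast
qed (rule grill_extension_least)

end
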